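(* Let $(X,b,m)$ be a connected weighted graph and let $\Omega\subsetneq X$ be a non-empty proper subset. Assume that $\mathrm{vol}(\Omega)<\infty$ and that the inradius $R_\Omega$ of $\Omega$ is finite. Then $$\lambda_0^D(\Omega)\ \ge\ \frac{1}{R_\Omega\,\mathrm{vol}(\Omega)} .$$
   Context: A weighted graph is a triple $(X,b,m)$ where $X$ is an arbitrary set (of vertices), $b:X\times X\to[0,\infty)$ is symmetric with $b(x,x)=0$ for all $x\in X$, and $m:X\to(0,\infty)$ is a function. No local finiteness or summability of $b$ is assumed. For $A\subset X$ put $\mathrm{vol}(A)=\sum_{x\in A}m(x)\in[0,\infty]$. A path from $x$ to $y$ is a finite sequence $\gamma=(x_0,\dots,x_k)$ in $X$ with $x_0=x$, $x_k=y$ and $b(x_l,x_{l+1})>0$ for $l=0,\dots,k-1$; its length is $L(\gamma)=\sum_{j=0}^{k-1}\frac{1}{b(x_j,x_{j+1})}$. The graph is connected if any two vertices are joined by a path. The pseudo-metric $d$ is $d(x,y)=\inf\{L(\gamma)\mid\gamma\text{ a path from }x\text{ to }y\}$ with $d(x,x)=0$ (it need not separate points). Open balls are $U_r(x)=\{y\in X\mid d(x,y)<r\}$. The inradius of $\Omega\subset X$ is $$R_\Omega=\sup\{r>0\mid \text{there exists }x\in\Omega\text{ with }U_r(x)\subset\Omega\},$$ with the supremum of the empty set taken to be $0$. The energy is $\mathcal{E}(f)=\frac12\sum_{x,y\in X}b(x,y)(f(x)-f(y))^2\in[0,\infty]$ for $f:X\to\mathbb{R}$. The Hilbert space $\ell^2(X,m)$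 consists of $f:X\to\mathbb{R}$ with $\sum_{x}f(x)^2m(x)<\infty$, with norm $\|f\|=\left(\sum_x f(x)^2m(x)\right)^{1/2}$. For $\Omega\subset X$, $$\lambda_0^D(\Omega)=\inf\{\mathcal{E}(f)\mid f\in\ell^2(X,m),\ \mathcal{E}(f)<\infty,\ f=0\text{ on }X\setminus\Omega,\ \|f\|=1\},$$ with $\inf\emptyset=\infty$. The convention $1/0=\infty$ is used. *)

theory Defs
  imports "HOL-Analysis.Infinite_Sum"
begin

text \<open>
  The vertex set \<open>X\<close> is the whole type \<open>'a\<close>. All quantities with values in \<open>[0,\<infinity>]\<close> are of type
  \<^typ>\<open>ennreal\<close>, in which every family is summable, \<open>Sup {} = 0\<close>, \<open>Inf {} = \<infinity>\<close> and \<open>1 / 0 = \<infinity>\<close>.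
\<close>

locale weighted_graph =
  fixes b :: "'a \<Rightarrow> 'a \<Rightarrow> real" and m :: "'a \<Rightarrow> real"
  assumes b_nonneg: "b x y \<ge> 0"
    and b_sym: "b x y = b y x"
    and b_diag: "b x x = 0"
    and m_pos: "m x > 0"

definition vol :: "('a \<Rightarrow> real) \<Rightarrow> 'a set \<Rightarrow> ennreal" where
  "vol m A = (\<Sum>\<^sub>\<infinity>x\<in>A. ennreal (m x))"

text \<open>A path \<open>(x\<^sub>0, \<dots>, x\<^sub>k)\<close> is a list of \<open>k + 1\<close> vertices; \<open>k = 0\<close> is allowed.\<close>

definition graph_path :: "('a \<Rightarrow> 'a \<Rightarrow> real) \<Rightarrow> 'a \<Rightarrow> 'a \<Rightarrow> 'a list \<Rightarrow> bool" where
  "graph_path b x y \<gamma> \<longleftrightarrow> \<gamma> \<noteq> [] \<and> hd \<gamma> = x \<and> last \<gamma> = y \<and>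
     (\<forall>l < length \<gamma> - 1. b (\<gamma> ! l) (\<gamma> ! Suc l) > 0)"

definition graph_path_length :: "('a \<Rightarrow> 'a \<Rightarrow> real) \<Rightarrow> 'a list \<Rightarrow> real" where
  "graph_path_length b \<gamma> = (\<Sum>j < length \<gamma> - 1. 1 / b (\<gamma> ! j) (\<gamma> ! Suc j))"

definition graph_connected :: "('a \<Rightarrow> 'a \<Rightarrow> real) \<Rightarrow> bool" where
  "graph_connected b \<longleftrightarrow> (\<forall>x y. \<exists>\<gamma>. graph_path b x y \<gamma>)"

text \<open>The value is finite if the graph is connected, and \<open>\<infinity>\<close> between different components.\<close>

definition graph_dist :: "('a \<Rightarrow> 'a \<Rightarrow> real) \<Rightarrow> 'a \<Rightarrow> 'a \<Rightarrow> ennreal" where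
  "graph_dist b x y = Inf {ennreal (graph_path_length b \<gamma>) | \<gamma>. graph_path b x y \<gamma>}"

lemma graph_dist_self: "graph_dist b x x = 0"
proof -
  have "graph_path b x x [x]"
    by (simp add: graph_path_def)
  then have "graph_dist b x x \<le> ennreal (graph_path_length b [x])"
    unfolding graph_dist_def by (intro Inf_lower) blast
  then show ?thesis
    by (simp add: graph_path_length_def)
qed

definition graph_ball :: "('a \<Rightarrow> 'a \<Rightarrow> real) \<Rightarrow> real \<Rightarrow> 'a \<Rightarrow> 'a set" where
  "graph_ball b r x = {y. graph_dist b x y < ennreal r}"

definition inradius :: "('a \<Rightarrow> 'a \<Rightarrow> real) \<Rightarrow> 'a set \<Rightarrow> ennreal" where
  "inradius b \<Omega> = Sup {ennreal r | r. r > 0 \<and> (\<exists>x\<in>\<Omega>. graph_ball b r x \<subseteq> \<Omega>)}"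

definition energy :: "('a \<Rightarrow> 'a \<Rightarrow> real) \<Rightarrow> ('a \<Rightarrow> real) \<Rightarrow> ennreal" where
  "energy b f = 1 / 2 * (\<Sum>\<^sub>\<infinity>(x, y)\<in>UNIV. ennreal (b x y * (f x - f y)\<^sup>2))"

definition l2 :: "('a \<Rightarrow> real) \<Rightarrow> ('a \<Rightarrow> real) set" where
  "l2 m = {f. (\<lambda>x. (f x)\<^sup>2 * m x) summable_on UNIV}"

definition l2_norm :: "('a \<Rightarrow> real) \<Rightarrow> ('a \<Rightarrow> real) \<Rightarrow> real" where
  "l2_norm m f = sqrt (\<Sum>\<^sub>\<infinity>x. (f x)\<^sup>2 * m x)"

definition lambda0D :: "('a \<Rightarrow> 'a \<Rightarrow> real) \<Rightarrow> ('a \<Rightarrow> real) \<Rightarrow> 'a set \<Rightarrow> ennreal" where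
  "lambda0D b m \<Omega> =
     Inf {energy b f | f. f \<in> l2 m \<and> energy b f < \<infinity> \<and> (\<forall>x. x \<notin> \<Omega> \<longrightarrow> f x = 0) \<and> l2_norm m f = 1}"

end

theory Submission
  imports Defs "HOL-Analysis.Convex"
begin

text \<open>
  The energy controls oscillation along paths. For a path \<open>\<gamma>\<close> from \<open>x\<close> to \<open>y\<close>, telescoping \<open>f x - f y\<close>
  and applying the Cauchy--Schwarz inequality with the weights \<open>1 / b\<close> and \<open>b\<close> of the edges bounds
  \<open>(f x - f y)\<^sup>2\<close> by the length of \<open>\<gamma>\<close> times the part of the energy that sits on the edges of \<open>\<gamma>\<close>.
  If \<open>\<gamma>\<close> has no repeated vertex, that part is at most the whole energy
  (\<open>energy_ge_distinct_path\<close>), and cutting out loops only shortens a path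
  (\<open>graph_path_remove_loops\<close>). Hence \<open>(f x - f y)\<^sup>2\<close> is at most the length of any path times the
  energy (\<open>diff_sq_le_path_length_mult_energy\<close>).

  Let \<open>f\<close> vanish outside \<open>\<Omega>\<close> and let \<open>r\<close> exceed the inradius. No ball of radius \<open>r\<close> about a point
  \<open>x\<close> of \<open>\<Omega>\<close> stays inside \<open>\<Omega>\<close>, so a path of length below \<open>r\<close> leads from \<open>x\<close> to a zero of \<open>f\<close>
  (\<open>short_path_leaving\<close>), which gives \<open>(f x)\<^sup>2 \<le> r * energy b f\<close>. Integrating over \<open>\<Omega>\<close> gives
  \<open>1 \<le> r * energy b f * vol m \<Omega>\<close> for normalised \<open>f\<close>, and it remains to let \<open>r\<close> decrease to the
  inradius.
\<close>

section \<open>Paths without repeated vertices\<close>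

lemma graph_path_Cons_Cons:
  "graph_path b x y (u # v # \<gamma>) \<longleftrightarrow> x = u \<and> b u v > 0 \<and> graph_path b v y (v # \<gamma>)"
  by (auto simp: graph_path_def less_Suc_eq_0_disj)

lemma graph_path_length_Cons_Cons:
  "graph_path_length b (u # v # \<gamma>) = 1 / b u v + graph_path_length b (v # \<gamma>)"
  by (simp add: graph_path_length_def sum.lessThan_Suc_shift del: sum.lessThan_Suc)

lemma graph_path_suffix:
  assumes "graph_path b x y (\<gamma> @ u # \<gamma>')"
  shows "graph_path b u y (u # \<gamma>')"
    and "graph_path_length b (u # \<gamma>') \<le> graph_path_length b (\<gamma> @ u # \<gamma>')"
proof -
  have "graph_path b u y (u # \<gamma>') \<and>
      graph_path_length b (u # \<gamma>') \<le> graph_path_length b (\<gamma> @ u # \<gamma>')"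
    using assms
  proof (induction \<gamma> arbitrary: x)
    case Nil
    then show ?case by (auto simp: graph_path_def)
  next
    case (Cons w \<gamma>)
    obtain v \<delta> where \<delta>: "\<gamma> @ u # \<gamma>' = v # \<delta>"
      by (cases "\<gamma> @ u # \<gamma>'") auto
    from Cons.prems have "b w v > 0" "graph_path b v y (\<gamma> @ u # \<gamma>')"
      by (simp_all add: \<delta> graph_path_Cons_Cons)
    moreover from this(1) have "graph_path_length b (v # \<delta>) \<le> graph_path_length b (w # v # \<delta>)"
      by (simp add: graph_path_length_Cons_Cons)
    ultimately show ?case using Cons.IH[of v] \<delta> by (metis append_Cons order_trans)
  qed
  then show "graph_path b u y (u # \<gamma>')"
    "graph_path_length b (u # \<gamma>') \<le> graph_path_length b (\<gamma> @ u # \<gamma>')" by auto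
qed

text \<open>
  Induction along the path: once its tail is free of repetitions, the first vertex can reappear only
  once, and then the part of the tail that starts there already joins the two end points.
\<close>

lemma graph_path_remove_loops:
  assumes "graph_path b x y \<gamma>"
  obtains \<gamma>' where "graph_path b x y \<gamma>'" "distinct \<gamma>'"
    "graph_path_length b \<gamma>' \<le> graph_path_length b \<gamma>"
proof -
  have "\<exists>\<gamma>'. graph_path b x y \<gamma>' \<and> distinct \<gamma>' \<and>
      graph_path_length b \<gamma>' \<le> graph_path_length b \<gamma>"
    using assms
  proof (induction \<gamma> arbitrary: x rule: induct_list012)
    case 1
    then show ?case by (simp add: graph_path_def)
  next
    case (2 u)
    then show ?case by (intro exI[of _ "[u]"]) simp
  next
    case (3 u v \<gamma>)
    from "3.prems" have x: "x = u" and pos: "b u v > 0" and tail: "graph_path b v y (v # \<gamma>)"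
      by (simp_all add: graph_path_Cons_Cons)
    from "3.IH"(2)[OF tail] obtain \<delta> where \<delta>: "graph_path b v y \<delta>" "distinct \<delta>"
      "graph_path_length b \<delta> \<le> graph_path_length b (v # \<gamma>)"
      by blast
    obtain \<delta>' where \<delta>': "\<delta> = v # \<delta>'"
      using \<delta>(1) by (cases \<delta>) (auto simp: graph_path_def)
    show ?case
    proof (cases "u \<in> set \<delta>")
      case True
      then obtain \<alpha> \<beta> where split: "\<delta> = \<alpha> @ u # \<beta>"
        by (meson split_list)
      have "graph_path_length b (u # \<beta>) \<le> graph_path_length b \<delta>"
        using graph_path_suffix(2) \<delta>(1) split by metis
      also have "\<dots> \<le> graph_path_length b (u # v # \<gamma>)"
        using \<delta>(3) pos by (simp add: graph_path_length_Cons_Cons add_increasing)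
      finally show ?thesis
        using graph_path_suffix(1)[of b v y \<alpha> u \<beta>] \<delta> split x by auto
    next
      case False
      then show ?thesis
        using \<delta> \<delta>' pos x
        by (intro exI[of _ "u # \<delta>"]) (simp add: graph_path_Cons_Cons graph_path_length_Cons_Cons)
    qed
  qed
  then show thesis using that by blast
qed

section \<open>Energy along a path\<close>

lemma finite_sum_le_infsum_ennreal:
  assumes "finite F" "F \<subseteq> A" "\<And>x. x \<in> F \<Longrightarrow> g x \<ge> 0"
  shows "ennreal (\<Sum>x\<in>F. g x) \<le> (\<Sum>\<^sub>\<infinity>x\<in>A. ennreal (g x))"
proof -
  have "ennreal (\<Sum>x\<in>F. g x) = (\<Sum>\<^sub>\<infinity>x\<in>F. ennreal (g x))"
    using assms by (simp add: sum_ennreal)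
  also have "\<dots> \<le> (\<Sum>\<^sub>\<infinity>x\<in>A. ennreal (g x))"
    using assms by (intro infsum_mono_neutral) (auto intro: nonneg_summable_on_complete)
  finally show ?thesis .
qed

text \<open>
  The energy is half of a sum over ordered pairs. A path with distinct vertices uses each of its
  undirected edges once, so its edges together with their reversals are distinct ordered pairs; the
  factor \<open>1 / 2\<close> cancels this double count.
\<close>

lemma energy_ge_distinct_path:
  assumes "weighted_graph b m" "distinct \<gamma>"
  shows "ennreal (\<Sum>j < length \<gamma> - 1. b (\<gamma> ! j) (\<gamma> ! Suc j) * (f (\<gamma> ! j) - f (\<gamma> ! Suc j))\<^sup>2)
    \<le> energy b f"
proof -
  interpret weighted_graph b m by fact
  define n where "n = length \<gamma> - 1"
  define g where "g = (\<lambda>(x, y). b x y * (f x - f y)\<^sup>2)"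
  define e where "e j = (\<gamma> ! j, \<gamma> ! Suc j)" for j
  define e' where "e' j = (\<gamma> ! Suc j, \<gamma> ! j)" for j
  have g_nonneg: "g p \<ge> 0" for p
    by (auto simp: g_def b_nonneg split: prod.splits)
  have inj: "inj_on e {..<n}" "inj_on e' {..<n}"
    using \<open>distinct \<gamma>\<close> by (auto simp: inj_on_def e_def e'_def n_def nth_eq_iff_index_eq)
  have disj: "e ` {..<n} \<inter> e' ` {..<n} = {}"
    using \<open>distinct \<gamma>\<close> by (auto simp: e_def e'_def n_def nth_eq_iff_index_eq)
  define S where "S = (\<Sum>j<n. g (e j))"
  have "S = (\<Sum>j<n. g (e' j))"
    by (simp add: S_def g_def e_def e'_def b_sym power2_commute)
  then have "2 * S = (\<Sum>p\<in>e ` {..<n}. g p) + (\<Sum>p\<in>e' ` {..<n}. g p)"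
    by (simp add: sum.reindex[OF inj(1)] sum.reindex[OF inj(2)] S_def)
  also have "\<dots> = (\<Sum>p\<in>e ` {..<n} \<union> e' ` {..<n}. g p)"
    using disj by (simp add: sum.union_disjoint)
  finally have "ennreal (2 * S) \<le> (\<Sum>\<^sub>\<infinity>p\<in>UNIV. ennreal (g p))"
    using g_nonneg by (simp add: finite_sum_le_infsum_ennreal)
  then have "1 / 2 * ennreal (2 * S) \<le> energy b f"
    unfolding energy_def g_def by (intro mult_left_mono) (simp_all add: case_prod_unfold)
  moreover have "S \<ge> 0"
    by (simp add: S_def sum_nonneg g_nonneg)
  then have "1 / 2 * ennreal (2 * S) = ennreal S"
    by (simp add: ennreal_divide_times ennreal_divide_numeral)
  ultimately show ?thesis
    by (simp add: S_def g_def e_def n_def)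
qed

text \<open>
  Finiteness of the energy makes \<open>enn2real\<close> faithful here; it would send an infinite energy to \<open>0\<close>.
\<close>

lemma diff_sq_le_path_length_mult_energy:
  assumes "weighted_graph b m" "graph_path b x y \<gamma>"
    and fin: "energy b f < \<infinity>"
  shows "(f x - f y)\<^sup>2 \<le> graph_path_length b \<gamma> * enn2real (energy b f)"
proof -
  interpret weighted_graph b m by fact
  obtain \<delta> where \<delta>: "graph_path b x y \<delta>" "distinct \<delta>"
    and shorter: "graph_path_length b \<delta> \<le> graph_path_length b \<gamma>"
    using graph_path_remove_loops[OF assms(2)] .
  define n where "n = length \<delta> - 1"
  define c where "c j = b (\<delta> ! j) (\<delta> ! Suc j)" for j
  define h where "h j = f (\<delta> ! j)" for j
  have pos: "c j > 0" if "j < n" for j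
    using \<delta>(1) that by (auto simp: graph_path_def c_def n_def)
  have ends: "h 0 = f x" "h n = f y"
    using \<delta>(1) by (auto simp: graph_path_def h_def n_def hd_conv_nth last_conv_nth)
  have "f x - f y = (\<Sum>j<n. h j - h (Suc j))"
    by (simp add: sum_lessThan_telescope' ends)
  \<comment> \<open>The factors are chosen so that their squares are the edge lengths and the energies of the edges.\<close>
  also have "\<dots> = (\<Sum>j<n. (1 / sqrt (c j)) * (sqrt (c j) * (h j - h (Suc j))))"
    using pos by (intro sum.cong) (auto simp: less_imp_neq[symmetric])
  finally have "(f x - f y)\<^sup>2
      \<le> (\<Sum>j<n. (1 / sqrt (c j))\<^sup>2) * (\<Sum>j<n. (sqrt (c j) * (h j - h (Suc j)))\<^sup>2)"
    by (simp only: Cauchy_Schwarz_ineq_sum)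
  also have "(\<Sum>j<n. (1 / sqrt (c j))\<^sup>2) = graph_path_length b \<delta>"
    unfolding graph_path_length_def using pos
    by (intro sum.cong) (auto simp: c_def n_def power_divide less_imp_le)
  also have "(\<Sum>j<n. (sqrt (c j) * (h j - h (Suc j)))\<^sup>2) = (\<Sum>j<n. c j * (h j - h (Suc j))\<^sup>2)"
    using pos by (intro sum.cong) (auto simp: power_mult_distrib less_imp_le)
  also have "graph_path_length b \<delta> * \<dots> \<le> graph_path_length b \<gamma> * enn2real (energy b f)"
  proof (intro mult_mono shorter)
    have "0 \<le> graph_path_length b \<delta>"
      by (auto simp: graph_path_length_def b_nonneg intro!: sum_nonneg)
    then show "0 \<le> graph_path_length b \<gamma>" using shorter by simp
    show nonneg: "0 \<le> (\<Sum>j<n. c j * (h j - h (Suc j))\<^sup>2)"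
      using pos by (auto intro!: sum_nonneg simp: less_imp_le)
    have "ennreal (\<Sum>j<n. c j * (h j - h (Suc j))\<^sup>2) \<le> energy b f"
      unfolding c_def h_def n_def by (intro energy_ge_distinct_path[OF assms(1)] \<delta>)
    from enn2real_mono[OF this] show "(\<Sum>j<n. c j * (h j - h (Suc j))\<^sup>2) \<le> enn2real (energy b f)"
      using fin nonneg by simp
  qed
  finally show ?thesis .
qed

section \<open>The eigenvalue estimate\<close>

lemma short_path_leaving:
  assumes "x \<in> \<Omega>" "inradius b \<Omega> < ennreal r"
  obtains y \<gamma> where "y \<notin> \<Omega>" "graph_path b x y \<gamma>" "graph_path_length b \<gamma> < r"
proof -
  have "r > 0"
    using assms(2) by (metis ennreal_neg not_less not_less_zero)
  have "\<not> graph_ball b r x \<subseteq> \<Omega>"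
  proof
    assume "graph_ball b r x \<subseteq> \<Omega>"
    with \<open>x \<in> \<Omega>\<close> \<open>r > 0\<close> have "ennreal r \<le> inradius b \<Omega>"
      unfolding inradius_def by (intro Sup_upper) blast
    with assms(2) show False by simp
  qed
  then obtain y where y: "y \<notin> \<Omega>" "graph_dist b x y < ennreal r"
    by (auto simp: graph_ball_def)
  from y(2) obtain \<gamma> where "graph_path b x y \<gamma>" "ennreal (graph_path_length b \<gamma>) < ennreal r"
    unfolding graph_dist_def Inf_less_iff by blast
  then show thesis
    using that[OF y(1)] by (meson ennreal_leI not_less)
qed

lemma sq_l2_norm_le:
  assumes "weighted_graph b m" "vol m \<Omega> < \<infinity>"
    and f: "f \<in> l2 m" "\<And>x. x \<notin> \<Omega> \<Longrightarrow> f x = 0"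
    and bound: "\<And>x. x \<in> \<Omega> \<Longrightarrow> (f x)\<^sup>2 \<le> C" and "C \<ge> 0"
  shows "(l2_norm m f)\<^sup>2 \<le> C * enn2real (vol m \<Omega>)"
proof -
  interpret weighted_graph b m by fact
  have "(\<Sum>\<^sub>\<infinity>x. (f x)\<^sup>2 * m x) \<le> C * enn2real (vol m \<Omega>)"
  proof (rule infsum_le_finite_sums)
    show "(\<lambda>x. (f x)\<^sup>2 * m x) summable_on UNIV"
      using f(1) by (simp add: l2_def)
  next
    fix F :: "'a set" assume F: "finite F"
    have m: "0 \<le> m x" for x using m_pos[of x] by simp
    have "(\<Sum>x\<in>F. (f x)\<^sup>2 * m x) = (\<Sum>x\<in>F \<inter> \<Omega>. (f x)\<^sup>2 * m x)"
      using F f(2) by (intro sum.mono_neutral_right) auto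
    also have "\<dots> \<le> C * (\<Sum>x\<in>F \<inter> \<Omega>. m x)"
      unfolding sum_distrib_left by (intro sum_mono mult_right_mono bound m) auto
    also have "(\<Sum>x\<in>F \<inter> \<Omega>. m x) \<le> enn2real (vol m \<Omega>)"
    proof -
      have "ennreal (\<Sum>x\<in>F \<inter> \<Omega>. m x) \<le> vol m \<Omega>"
        unfolding vol_def using F m by (intro finite_sum_le_infsum_ennreal) auto
      then show ?thesis
        using assms(2) m by (metis enn2real_mono enn2real_ennreal infinity_ennreal_def sum_nonneg)
    qed
    finally show "(\<Sum>x\<in>F. (f x)\<^sup>2 * m x) \<le> C * enn2real (vol m \<Omega>)"
      using \<open>C \<ge> 0\<close> by (simp add: mult_left_mono)
  qed
  moreover have "(\<Sum>\<^sub>\<infinity>x. (f x)\<^sup>2 * m x) \<ge> 0"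
    using m_pos by (intro infsum_nonneg) (simp add: less_imp_le)
  ultimately show ?thesis by (simp add: l2_norm_def)
qed

theorem theorem3p2:
  fixes b :: "'a \<Rightarrow> 'a \<Rightarrow> real" and m :: "'a \<Rightarrow> real" and \<Omega> :: "'a set"
  assumes "weighted_graph b m"
    and "graph_connected b"
    and "\<Omega> \<noteq> {}" and "\<Omega> \<noteq> UNIV"
    and "vol m \<Omega> < \<infinity>"
    and "inradius b \<Omega> < \<infinity>"
  shows "lambda0D b m \<Omega> \<ge> 1 / (inradius b \<Omega> * vol m \<Omega>)"
  unfolding lambda0D_def
proof (rule Inf_greatest, clarify)
  fix f assume f: "f \<in> l2 m" "energy b f < \<infinity>" "\<forall>x. x \<notin> \<Omega> \<longrightarrow> f x = 0" "l2_norm m f = 1"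
  define E R V where "E = enn2real (energy b f)" and "R = enn2real (inradius b \<Omega>)"
    and "V = enn2real (vol m \<Omega>)"
  have fin: "energy b f = ennreal E" "inradius b \<Omega> = ennreal R" "vol m \<Omega> = ennreal V"
    and nonneg: "E \<ge> 0" "R \<ge> 0" "V \<ge> 0"
    using assms(5,6) f(2) by (simp_all add: E_def R_def V_def)
  have bound: "1 \<le> r * (E * V)" if "r > R" for r
  proof -
    have "(f x)\<^sup>2 \<le> r * E" if x: "x \<in> \<Omega>" for x
    proof -
      have "inradius b \<Omega> < ennreal r"
        using \<open>r > R\<close> nonneg by (simp add: fin ennreal_lessI)
      then obtain y \<gamma> where y: "y \<notin> \<Omega>" "graph_path b x y \<gamma>" "graph_path_length b \<gamma> < r"
        using short_path_leaving x by metis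
      have "(f x)\<^sup>2 = (f x - f y)\<^sup>2"
        using f(3) y(1) by simp
      also have "\<dots> \<le> graph_path_length b \<gamma> * E"
        unfolding E_def by (intro diff_sq_le_path_length_mult_energy[OF assms(1)] y f)
      also have "\<dots> \<le> r * E"
        using y(3) nonneg by (simp add: mult_right_mono)
      finally show ?thesis .
    qed
    then have "(l2_norm m f)\<^sup>2 \<le> r * E * V"
      unfolding V_def using f(3) nonneg \<open>r > R\<close>
      by (intro sq_l2_norm_le[OF assms(1,5) f(1)]) auto
    then show ?thesis using f(4) by (simp add: mult.assoc)
  qed
  \<comment> \<open>The bound excludes \<open>E * V = 0\<close>, so \<open>r\<close> may decrease to \<open>R\<close> in \<open>1 / (E * V) \<le> r\<close>.\<close>
  have "E * V > 0"
    using bound[of "R + 1"] nonneg by (cases "E * V = 0") (auto simp: less_le)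
  then have "1 / (E * V) \<le> r" if "r > R" for r
    using bound[OF that] by (simp add: divide_le_eq)
  then have "1 / (E * V) \<le> R"
    by (rule dense_ge)
  with \<open>E * V > 0\<close> have "1 \<le> E * (R * V)"
    by (simp add: divide_le_eq algebra_simps)
  \<comment> \<open>In particular \<open>R > 0\<close>: inradius \<open>0\<close> leaves no admissible \<open>f\<close> of finite energy, in accordance
    with \<open>1 / 0 = \<infinity>\<close>.\<close>
  then have pos: "R * V > 0" and "1 / (R * V) \<le> E"
    using nonneg by (auto simp: less_le divide_le_eq)
  then have "ennreal (1 / (R * V)) \<le> ennreal E"
    by (simp add: ennreal_leI)
  then show "1 / (inradius b \<Omega> * vol m \<Omega>) \<le> energy b f"
    using pos nonneg by (simp add: fin ennreal_mult[symmetric] divide_ennreal[symmetric])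
qed

end
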